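(* Let $G$ be a discrete group, $p\in[1,\infty)$, and let $\mathcal{X}$ be a Banach space. Let $\pi$ be a $p$-USF representation of $G$ on $\mathcal{X}$, i.e. the representation associated with some group-$p$-USF $(\{f_g\}_{g\in G},\{\tau_g\}_{g\in G})$ for $\mathcal{X}$. Then $\pi$ is invertibly isometrically equivalent to a subrepresentation of the $p$-left regular representation $\lambda$ of $G$ on $\ell^p(G)$.
   Context: Banach spaces are over $\mathbb{C}$ and separable; $\mathcal{X}^*$ is the dual of $\mathcal{X}$. A discrete group is a countable group with the discrete topology (not necessarily abelian). $\mathcal{II}(\mathcal{X})$ is the set of invertible (surjective) linear isometries of $\mathcal{X}$. An invertible isometric representation of a discrete group $G$ on $\mathcal{X}$ is a group homomorphism $\pi:G\to\mathcal{II}(\mathcal{X})$, $g\mapsto\pi_g$. Two such representations $\pi$ on $\mathcal{X}$ and $\Delta$ on $\mathcal{Y}$ are invertibly isometrically equivalent if there is an invertible linear isometry $T:\mathcal{X}\to\mathcal{Y}$ with $T\pi_g=\Delta_gT$ for all $g\in G$. A subrepresentation is the restriction of a representation to a closed invariant subspace. $\{\delta_g\}_{g\in G}$ is the standard Schauder basis of $\ell^p(G)$. The $p$-left regular representation $\lambda:G\to\mathcal{II}(\ell^p(G))$ is determined by $\lambda_g\delta_h=\delta_{gh}$ for all $g,h\in G$. An unconditional Schauder frame (USF) for $\mathcal{X}$ is a pair $(\{f_g\}_{g\in G},\{\tau_g\}_{g\in G})$ with $f_g\in\mathcal{X}^*$, $\tau_g\in\mathcal{X}$ such that $x=\sum_{g\in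 G}f_g(x)\tau_g$ for all $x\in\mathcal{X}$, with unconditional convergence. It is a group-USF if there exist an invertible isometric representation $\pi$ of $G$ on $\mathcal{X}$, $\tau\in\mathcal{X}$ and $f\in\mathcal{X}^*$ such that $f_g=f\pi_{g^{-1}}$ and $\tau_g=\pi_g\tau$ for all $g\in G$. A group-USF is a group-$p$-USF if (i) the analysis operator $\theta_f:\mathcal{X}\to\ell^p(G)$, $\theta_fx=\{f_g(x)\}_{g\in G}$, is a well-defined isometry, and (ii) the synthesis operator $\theta_\tau:\ell^p(G)\to\mathcal{X}$, $\theta_\tau\{a_g\}_{g\in G}=\sum_{g\in G}a_g\tau_g$, is a well-defined bounded linear operator. In this case $\pi$ is called a $p$-USF representation. *)

theory Defs
  imports "HOL-Analysis.Analysis" "HOL-Algebra.Bij" "HOL-Library.Function_Algebras"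
begin

section \<open>Complex Banach spaces with explicit carrier\<close>

text \<open>
  The sequence space over an index set depends on a real exponent, and subrepresentations live
  on subspaces, so normed spaces are structures rather than types: a complex vector
  space (addition taken from the type class, scalar multiplication explicit), a linear subspace of
  it as carrier, and a norm on that carrier.
\<close>

record 'v cnspace = "'v partial_object" +
  scl :: "complex \<Rightarrow> 'v \<Rightarrow> 'v"
  nrm :: "'v \<Rightarrow> real"

definition complex_normed_space :: "('v::ab_group_add) cnspace \<Rightarrow> bool" where
  "complex_normed_space X \<longleftrightarrow>
     vector_space (scl X) \<and> module.subspace (scl X) (carrier X) \<and>
     (\<forall>x\<in>carrier X. 0 \<le> nrm X x \<and> (nrm X x = 0 \<longleftrightarrow> x = 0)) \<and>
     (\<forall>c. \<forall>x\<in>carrier X. nrm X (scl X c x) = cmod c * nrm X x) \<and>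
     (\<forall>x\<in>carrier X. \<forall>y\<in>carrier X. nrm X (x + y) \<le> nrm X x + nrm X y)"

text \<open>The value off the carrier is irrelevant; \<open>0\<close> makes \<^locale>\<open>Metric_space\<close> applicable, which asks
  for nonnegativity and symmetry everywhere.\<close>

definition ndist :: "('v::ab_group_add) cnspace \<Rightarrow> 'v \<Rightarrow> 'v \<Rightarrow> real" where
  "ndist X x y = (if x \<in> carrier X \<and> y \<in> carrier X then nrm X (x - y) else 0)"

definition ntop :: "('v::ab_group_add) cnspace \<Rightarrow> 'v topology" where
  "ntop X = Metric_space.mtopology (carrier X) (ndist X)"

definition separable_cbanach :: "('v::ab_group_add) cnspace \<Rightarrow> bool" where
  "separable_cbanach X \<longleftrightarrow>
     complex_normed_space X \<and> Metric_space.mcomplete (carrier X) (ndist X) \<and>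
     (\<exists>D. countable D \<and> D \<subseteq> carrier X \<and> ntop X closure_of D = carrier X)"

definition clinear_map :: "('v::ab_group_add) cnspace \<Rightarrow> ('w::ab_group_add) cnspace \<Rightarrow> ('v \<Rightarrow> 'w) \<Rightarrow> bool" where
  "clinear_map X Y T \<longleftrightarrow>
     T \<in> carrier X \<rightarrow> carrier Y \<and>
     (\<forall>x\<in>carrier X. \<forall>y\<in>carrier X. T (x + y) = T x + T y) \<and>
     (\<forall>c. \<forall>x\<in>carrier X. T (scl X c x) = scl Y c (T x))"

definition bounded_clinear_map :: "('v::ab_group_add) cnspace \<Rightarrow> ('w::ab_group_add) cnspace \<Rightarrow> ('v \<Rightarrow> 'w) \<Rightarrow> bool" where
  "bounded_clinear_map X Y T \<longleftrightarrow>
     clinear_map X Y T \<and> (\<exists>B. \<forall>x\<in>carrier X. nrm Y (T x) \<le> B * nrm X x)"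

definition linear_isometry :: "('v::ab_group_add) cnspace \<Rightarrow> ('w::ab_group_add) cnspace \<Rightarrow> ('v \<Rightarrow> 'w) \<Rightarrow> bool" where
  "linear_isometry X Y T \<longleftrightarrow>
     clinear_map X Y T \<and> (\<forall>x\<in>carrier X. nrm Y (T x) = nrm X x)"

definition scalar_space :: "complex cnspace" where
  "scalar_space = \<lparr>carrier = UNIV, scl = (*), nrm = cmod\<rparr>"

definition dual :: "('v::ab_group_add) cnspace \<Rightarrow> ('v \<Rightarrow> complex) set" where
  "dual X = {f. bounded_clinear_map X scalar_space f}"

text \<open>Unconditional convergence is convergence of the net of finite partial sums.\<close>

definition has_usum :: "('v::ab_group_add) cnspace \<Rightarrow> ('i \<Rightarrow> 'v) \<Rightarrow> 'i set \<Rightarrow> 'v \<Rightarrow> bool" where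
  "has_usum X h I x \<longleftrightarrow> limitin (ntop X) (\<lambda>F. \<Sum>i\<in>F. h i) x (finite_subsets_at_top I)"


section \<open>The spaces \<open>\<ell>\<^sup>p(I)\<close>\<close>

text \<open>Families indexed by \<open>I\<close> are functions on the whole type that vanish outside \<open>I\<close>.\<close>

definition ell :: "real \<Rightarrow> 'i set \<Rightarrow> ('i \<Rightarrow> complex) cnspace" where
  "ell p I =
     \<lparr>carrier = {a. (\<forall>i. i \<notin> I \<longrightarrow> a i = 0) \<and> (\<lambda>i. cmod (a i) powr p) summable_on I},
      scl = (\<lambda>c a i. c * a i),
      nrm = (\<lambda>a. (\<Sum>\<^sub>\<infinity>i\<in>I. cmod (a i) powr p) powr (1 / p))\<rparr>"

definition unit_vec :: "'i \<Rightarrow> 'i \<Rightarrow> complex" where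
  "unit_vec h = (\<lambda>i. if i = h then 1 else 0)"


section \<open>Invertible isometric representations\<close>

definition discrete_group :: "('g, 'm) monoid_scheme \<Rightarrow> bool" where
  "discrete_group G \<longleftrightarrow> group G \<and> countable (carrier G)"

definition inv_isometries :: "('v::ab_group_add) cnspace \<Rightarrow> ('v \<Rightarrow> 'v) set" where
  "inv_isometries X = {T \<in> Bij (carrier X). linear_isometry X X T}"

definition inv_isometry_group :: "('v::ab_group_add) cnspace \<Rightarrow> ('v \<Rightarrow> 'v) monoid" where
  "inv_isometry_group X = (BijGroup (carrier X))\<lparr>carrier := inv_isometries X\<rparr>"

definition inv_isom_rep ::
    "('g, 'm) monoid_scheme \<Rightarrow> ('v::ab_group_add) cnspace \<Rightarrow> ('g \<Rightarrow> 'v \<Rightarrow> 'v) \<Rightarrow> bool" where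
  "inv_isom_rep G X \<pi> \<longleftrightarrow> \<pi> \<in> hom G (inv_isometry_group X)"

definition inv_isom_equivalent ::
    "('g, 'm) monoid_scheme \<Rightarrow> ('v::ab_group_add) cnspace \<Rightarrow> ('g \<Rightarrow> 'v \<Rightarrow> 'v) \<Rightarrow>
     ('w::ab_group_add) cnspace \<Rightarrow> ('g \<Rightarrow> 'w \<Rightarrow> 'w) \<Rightarrow> bool" where
  "inv_isom_equivalent G X \<pi> Y \<Delta> \<longleftrightarrow>
     inv_isom_rep G X \<pi> \<and> inv_isom_rep G Y \<Delta> \<and>
     (\<exists>T. linear_isometry X Y T \<and> bij_betw T (carrier X) (carrier Y) \<and>
          (\<forall>g\<in>carrier G. \<forall>x\<in>carrier X. T (\<pi> g x) = \<Delta> g (T x)))"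

definition closed_invariant_subspace ::
    "('g, 'm) monoid_scheme \<Rightarrow> ('v::ab_group_add) cnspace \<Rightarrow> ('g \<Rightarrow> 'v \<Rightarrow> 'v) \<Rightarrow> 'v set \<Rightarrow> bool" where
  "closed_invariant_subspace G X \<pi> W \<longleftrightarrow>
     W \<subseteq> carrier X \<and> module.subspace (scl X) W \<and> closedin (ntop X) W \<and>
     (\<forall>g\<in>carrier G. \<pi> g ` W \<subseteq> W)"

definition is_subrep ::
    "('g, 'm) monoid_scheme \<Rightarrow> ('v::ab_group_add) cnspace \<Rightarrow> ('g \<Rightarrow> 'v \<Rightarrow> 'v) \<Rightarrow>
     'v cnspace \<Rightarrow> ('g \<Rightarrow> 'v \<Rightarrow> 'v) \<Rightarrow> bool" where
  "is_subrep G X \<pi> Y \<rho> \<longleftrightarrow>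
     (\<exists>W. closed_invariant_subspace G X \<pi> W \<and> Y = X\<lparr>carrier := W\<rparr> \<and> \<rho> = (\<lambda>g. restrict (\<pi> g) W))"

definition left_regular ::
    "real \<Rightarrow> ('g, 'm) monoid_scheme \<Rightarrow> 'g \<Rightarrow> ('g \<Rightarrow> complex) \<Rightarrow> ('g \<Rightarrow> complex)" where
  "left_regular p G g =
     (THE T. T \<in> inv_isometries (ell p (carrier G)) \<and>
             (\<forall>h\<in>carrier G. T (unit_vec h) = unit_vec (g \<otimes>\<^bsub>G\<^esub> h)))"


section \<open>Group \<open>p\<close>-unconditional Schauder frames\<close>

definition usf ::
    "('v::ab_group_add) cnspace \<Rightarrow> 'i set \<Rightarrow> ('i \<Rightarrow> 'v \<Rightarrow> complex) \<Rightarrow> ('i \<Rightarrow> 'v) \<Rightarrow> bool" where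
  "usf X I fs ts \<longleftrightarrow>
     (\<forall>i\<in>I. fs i \<in> dual X) \<and> (\<forall>i\<in>I. ts i \<in> carrier X) \<and>
     (\<forall>x\<in>carrier X. has_usum X (\<lambda>i. scl X (fs i x) (ts i)) I x)"

definition analysis_op :: "'i set \<Rightarrow> ('i \<Rightarrow> 'v \<Rightarrow> complex) \<Rightarrow> 'v \<Rightarrow> 'i \<Rightarrow> complex" where
  "analysis_op I fs x = (\<lambda>i. if i \<in> I then fs i x else 0)"

definition synthesis_op ::
    "('v::ab_group_add) cnspace \<Rightarrow> 'i set \<Rightarrow> ('i \<Rightarrow> 'v) \<Rightarrow> ('i \<Rightarrow> complex) \<Rightarrow> 'v" where
  "synthesis_op X I ts a = (THE x. has_usum X (\<lambda>i. scl X (a i) (ts i)) I x)"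

definition group_usf ::
    "('g, 'm) monoid_scheme \<Rightarrow> ('v::ab_group_add) cnspace \<Rightarrow> ('g \<Rightarrow> 'v \<Rightarrow> 'v) \<Rightarrow>
     ('g \<Rightarrow> 'v \<Rightarrow> complex) \<Rightarrow> ('g \<Rightarrow> 'v) \<Rightarrow> bool" where
  "group_usf G X \<pi> fs ts \<longleftrightarrow>
     usf X (carrier G) fs ts \<and> inv_isom_rep G X \<pi> \<and>
     (\<exists>t\<in>carrier X. \<exists>f\<in>dual X. \<forall>g\<in>carrier G.
        (\<forall>x\<in>carrier X. fs g x = f (\<pi> (inv\<^bsub>G\<^esub> g) x)) \<and> ts g = \<pi> g t)"

text \<open>The group carries no ordering, so the synthesis series is summed unconditionally. The third
  conjunct says that this sum exists, hence that the definite description in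
  \<^const>\<open>synthesis_op\<close> is proper.\<close>

definition group_p_usf ::
    "real \<Rightarrow> ('g, 'm) monoid_scheme \<Rightarrow> ('v::ab_group_add) cnspace \<Rightarrow> ('g \<Rightarrow> 'v \<Rightarrow> 'v) \<Rightarrow>
     ('g \<Rightarrow> 'v \<Rightarrow> complex) \<Rightarrow> ('g \<Rightarrow> 'v) \<Rightarrow> bool" where
  "group_p_usf p G X \<pi> fs ts \<longleftrightarrow>
     group_usf G X \<pi> fs ts \<and>
     linear_isometry X (ell p (carrier G)) (analysis_op (carrier G) fs) \<and>
     (\<forall>a\<in>carrier (ell p (carrier G)). \<exists>x. has_usum X (\<lambda>g. scl X (a g) (ts g)) (carrier G) x) \<and>
     bounded_clinear_map (ell p (carrier G)) X (synthesis_op X (carrier G) ts)"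

definition p_usf_rep ::
    "real \<Rightarrow> ('g, 'm) monoid_scheme \<Rightarrow> ('v::ab_group_add) cnspace \<Rightarrow> ('g \<Rightarrow> 'v \<Rightarrow> 'v) \<Rightarrow> bool" where
  "p_usf_rep p G X \<pi> \<longleftrightarrow> (\<exists>fs ts. group_p_usf p G X \<pi> fs ts)"


section \<open>The structures above are as intended\<close>

lemma Metric_space_ndist:
  assumes "complex_normed_space X"
  shows "Metric_space (carrier X) (ndist X)"
proof -
  interpret V: vector_space "scl X" using assms by (simp add: complex_normed_space_def)
  have sub: "V.subspace (carrier X)" using assms by (simp add: complex_normed_space_def)
  have n: "0 \<le> nrm X x" "nrm X x = 0 \<longleftrightarrow> x = 0" if "x \<in> carrier X" for x
    using assms that by (auto simp: complex_normed_space_def)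
  have sc: "nrm X (scl X c x) = cmod c * nrm X x" if "x \<in> carrier X" for x c
    using assms that by (auto simp: complex_normed_space_def)
  have tri: "nrm X (x + y) \<le> nrm X x + nrm X y" if "x \<in> carrier X" "y \<in> carrier X" for x y
    using assms that by (auto simp: complex_normed_space_def)
  have d: "x - y \<in> carrier X" if "x \<in> carrier X" "y \<in> carrier X" for x y
    using sub that by (rule V.subspace_diff)
  show ?thesis
  proof
    show "0 \<le> ndist X x y" for x y using n d by (simp add: ndist_def)
    have "nrm X (x - y) = nrm X (y - x)" if "x \<in> carrier X" "y \<in> carrier X" for x y
      using sc[OF d[OF that], of "-1"] by simp
    then show "ndist X x y = ndist X y x" for x y by (simp add: ndist_def)
    show "ndist X x y = 0 \<longleftrightarrow> x = y" if "x \<in> carrier X" "y \<in> carrier X" for x y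
      using n d that by (simp add: ndist_def)
    show "ndist X x z \<le> ndist X x y + ndist X y z"
      if "x \<in> carrier X" "y \<in> carrier X" "z \<in> carrier X" for x y z
      using tri[OF d[of x y] d[of y z]] that by (simp add: ndist_def)
  qed
qed

lemma carrier_ell:
  "a \<in> carrier (ell p I) \<longleftrightarrow> (\<forall>i. i \<notin> I \<longrightarrow> a i = 0) \<and> (\<lambda>i. cmod (a i) powr p) summable_on I"
  by (simp add: ell_def)

lemma nrm_ell: "nrm (ell p I) a = (\<Sum>\<^sub>\<infinity>i\<in>I. cmod (a i) powr p) powr (1 / p)"
  by (simp add: ell_def)

lemma scl_ell: "scl (ell p I) c a = (\<lambda>i. c * a i)"
  by (simp add: ell_def)

lemma powr_add_le:
  fixes u v t p :: real
  assumes "1 \<le> p" "0 \<le> u" "0 \<le> v" "0 < t" "t < 1"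
  shows "(u + v) powr p \<le> t powr (1 - p) * u powr p + (1 - t) powr (1 - p) * v powr p"
proof (cases "u = 0 \<or> v = 0")
  case True
  have ge1: "1 \<le> s powr (1 - p)" if "0 < s" "s < 1" for s
    using that assms(1) powr_mono'[of "1 - p" 0 s] by simp
  have "u powr p \<le> t powr (1 - p) * u powr p"
    using ge1[of t] assms mult_right_mono[of 1 "t powr (1 - p)" "u powr p"] by simp
  moreover have "v powr p \<le> (1 - t) powr (1 - p) * v powr p"
    using ge1[of "1 - t"] assms mult_right_mono[of 1 "(1 - t) powr (1 - p)" "v powr p"] by simp
  ultimately show ?thesis using True assms by auto
next
  case False
  then have "((1 - t) * (v / (1 - t)) + t * (u / t)) powr p
      \<le> (1 - t) * (v / (1 - t)) powr p + t * (u / t) powr p"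
    using convex_onD[OF powr_convex[OF assms(1)], of t "v / (1 - t)" "u / t"] assms by simp
  moreover have "s * (w / s) powr p = s powr (1 - p) * w powr p" if "0 < s" "0 \<le> w" for s w
    using that by (simp add: powr_divide powr_diff)
  ultimately show ?thesis using assms by (simp add: add.commute)
qed

lemma ell_add_summable:
  assumes "1 \<le> p" "a \<in> carrier (ell p I)" "b \<in> carrier (ell p I)" "0 < t" "t < 1"
  shows "a + b \<in> carrier (ell p I)"
    and "(\<Sum>\<^sub>\<infinity>i\<in>I. cmod ((a + b) i) powr p) \<le>
      t powr (1 - p) * (\<Sum>\<^sub>\<infinity>i\<in>I. cmod (a i) powr p) + (1 - t) powr (1 - p) * (\<Sum>\<^sub>\<infinity>i\<in>I. cmod (b i) powr p)"
proof -
  let ?u = "\<lambda>i. t powr (1 - p) * cmod (a i) powr p + (1 - t) powr (1 - p) * cmod (b i) powr p"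
  have sa: "(\<lambda>i. cmod (a i) powr p) summable_on I" and sb: "(\<lambda>i. cmod (b i) powr p) summable_on I"
    using assms by (auto simp: carrier_ell)
  have su: "?u summable_on I"
    by (intro summable_on_add summable_on_cmult_right sa sb)
  have le: "cmod ((a + b) i) powr p \<le> ?u i" for i
  proof -
    have "cmod ((a + b) i) powr p \<le> (cmod (a i) + cmod (b i)) powr p"
      using assms(1) by (intro powr_mono2) (auto simp: norm_triangle_ineq)
    also have "\<dots> \<le> ?u i" using assms by (intro powr_add_le) auto
    finally show ?thesis .
  qed
  have s: "(\<lambda>i. cmod ((a + b) i) powr p) summable_on I"
  proof (rule summable_on_comparison_test[OF su])
  qed (use le in auto)
  then show "a + b \<in> carrier (ell p I)" using assms by (simp add: carrier_ell)
  have "(\<Sum>\<^sub>\<infinity>i\<in>I. cmod ((a + b) i) powr p) \<le> infsum ?u I"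
    by (rule infsum_mono[OF s su le])
  also have "\<dots> = t powr (1 - p) * (\<Sum>\<^sub>\<infinity>i\<in>I. cmod (a i) powr p) + (1 - t) powr (1 - p) * (\<Sum>\<^sub>\<infinity>i\<in>I. cmod (b i) powr p)"
    by (subst infsum_add) (auto intro!: summable_on_cmult_right sa sb simp: infsum_cmult_right')
  finally show "(\<Sum>\<^sub>\<infinity>i\<in>I. cmod ((a + b) i) powr p) \<le> \<dots>" .
qed

lemma nrm_ell_powr:
  assumes "1 \<le> p" shows "(\<Sum>\<^sub>\<infinity>i\<in>I. cmod (a i) powr p) = nrm (ell p I) a powr p"
  using assms by (simp add: nrm_ell powr_powr infsum_nonneg)

lemma coord_le_nrm_ell:
  assumes "1 \<le> p" "a \<in> carrier (ell p I)"
  shows "cmod (a i) \<le> nrm (ell p I) a"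
proof (cases "i \<in> I")
  case True
  have "cmod (a i) powr p \<le> (\<Sum>\<^sub>\<infinity>i\<in>I. cmod (a i) powr p)"
    using finite_sum_le_infsum[of "\<lambda>i. cmod (a i) powr p" I "{i}"] assms True by (simp add: carrier_ell)
  then have "(cmod (a i) powr p) powr (1 / p) \<le> nrm (ell p I) a"
    unfolding nrm_ell using assms by (intro powr_mono2) auto
  then show ?thesis using assms by (simp add: powr_powr)
qed (use assms in \<open>simp add: carrier_ell nrm_ell\<close>)

lemma complex_normed_space_ell:
  assumes p: "1 \<le> p" shows "complex_normed_space (ell p I)"
proof -
  interpret V: vector_space "scl (ell p I)"
    by unfold_locales (auto simp: scl_ell algebra_simps)
  have add: "a + b \<in> carrier (ell p I)" if "a \<in> carrier (ell p I)" "b \<in> carrier (ell p I)" for a b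
    using ell_add_summable(1)[OF p that, of "1/2"] by simp
  have cn: "cmod (c * z) powr p = cmod c powr p * cmod z powr p" for c z
    by (simp add: norm_mult powr_mult)
  have sc: "scl (ell p I) c a \<in> carrier (ell p I)" if "a \<in> carrier (ell p I)" for a c
    using that unfolding carrier_ell scl_ell cn by (auto intro: summable_on_cmult_right)
  have z: "0 \<in> carrier (ell p I)" by (simp add: carrier_ell)
  have nn: "0 \<le> nrm (ell p I) a" for a by (simp add: nrm_ell)
  have n0: "nrm (ell p I) a = 0 \<longleftrightarrow> a = 0" if "a \<in> carrier (ell p I)" for a
  proof
    assume "nrm (ell p I) a = 0"
    then show "a = 0" using coord_le_nrm_ell[OF p that] by auto
  qed (simp add: nrm_ell)
  have hom: "nrm (ell p I) (scl (ell p I) c a) = cmod c * nrm (ell p I) a" for c a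
    using p unfolding nrm_ell scl_ell cn infsum_cmult_right'
    by (simp add: powr_mult infsum_nonneg powr_powr)
  have tri: "nrm (ell p I) (a + b) \<le> nrm (ell p I) a + nrm (ell p I) b"
    if a: "a \<in> carrier (ell p I)" and b: "b \<in> carrier (ell p I)" for a b
  proof (cases "a = 0 \<or> b = 0")
    case True
    then show ?thesis using nn by auto
  next
    case False
    define A B where "A = nrm (ell p I) a" and "B = nrm (ell p I) b"
    have AB: "0 < A" "0 < B" using False n0 a b nn unfolding A_def B_def by (metis less_eq_real_def)+
    define t where "t = A / (A + B)"
    have t: "0 < t" "t < 1" "1 - t = B / (A + B)" using AB by (auto simp: t_def field_simps)
    have e: "(w / (A + B)) powr (1 - p) * w powr p = w * (A + B) powr (p - 1)" if "0 < w" for w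
    proof -
      have "(w / (A + B)) powr (1 - p) * w powr p = (w powr (1 - p) * w powr p) / (A + B) powr (1 - p)"
        using AB that by (simp add: powr_divide)
      also have "w powr (1 - p) * w powr p = w" using that by (simp flip: powr_add)
      also have "w / (A + B) powr (1 - p) = w * (A + B) powr (p - 1)"
        using powr_minus_divide[of "A + B" "1 - p"] by simp
      finally show ?thesis .
    qed
    have "nrm (ell p I) (a + b) powr p \<le> t powr (1 - p) * A powr p + (1 - t) powr (1 - p) * B powr p"
      using ell_add_summable(2)[OF p a b t(1,2)] unfolding nrm_ell_powr[OF p] A_def B_def .
    also have "\<dots> = A * (A + B) powr (p - 1) + B * (A + B) powr (p - 1)"
      unfolding t(3) e[OF AB(2)] unfolding t_def e[OF AB(1)] ..
    also have "\<dots> = (A + B) powr p" using AB powr_mult_base[of "A + B" "p - 1"] by (simp add: algebra_simps)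
    finally have "nrm (ell p I) (a + b) powr p \<le> (A + B) powr p" .
    then show ?thesis using p AB nn powr_less_mono2[of p "A + B" "nrm (ell p I) (a + b)"]
      unfolding A_def B_def by (smt (verit))
  qed
  show ?thesis
    unfolding complex_normed_space_def
    using V.vector_space_axioms V.subspaceI[OF z add sc] nn n0 hom tri by blast
qed

lemma ell_split:
  assumes "1 \<le> p" "a \<in> carrier (ell p I)" "finite F" "F \<subseteq> I"
  shows "(\<lambda>i. if i \<in> F then a i else 0) \<in> carrier (ell p I)"
    and "(\<lambda>i. if i \<in> F then 0 else a i) \<in> carrier (ell p I)"
    and "nrm (ell p I) (\<lambda>i. if i \<in> F then 0 else a i) powr p
         = (\<Sum>\<^sub>\<infinity>i\<in>I. cmod (a i) powr p) - (\<Sum>i\<in>F. cmod (a i) powr p)"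
proof -
  let ?f = "\<lambda>i. cmod (if i \<in> F then a i else 0) powr p"
  let ?r = "\<lambda>i. cmod (if i \<in> F then 0 else a i) powr p"
  let ?a = "\<lambda>i. cmod (a i) powr p"
  have sa: "?a summable_on I" using assms by (simp add: carrier_ell)
  have "?f summable_on F \<longleftrightarrow> ?f summable_on I"
    using assms(4) by (intro summable_on_cong_neutral) auto
  then have sf: "?f summable_on I" using assms(3) by simp
  have "infsum ?f F = infsum ?f I"
    using assms(4) by (intro infsum_cong_neutral) auto
  then have ef: "infsum ?f I = sum ?a F" using assms(3) by simp
  have sr: "?r summable_on I"
    by (rule summable_on_comparison_test[OF sa]) auto
  show "(\<lambda>i. if i \<in> F then a i else 0) \<in> carrier (ell p I)"
    using sf assms(2) by (simp add: carrier_ell)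
  show "(\<lambda>i. if i \<in> F then 0 else a i) \<in> carrier (ell p I)"
    using sr assms(2) by (simp add: carrier_ell)
  have "infsum ?a I = infsum (\<lambda>i. ?r i + ?f i) I" by (intro infsum_cong) auto
  also have "\<dots> = infsum ?r I + infsum ?f I" by (rule infsum_add[OF sr sf])
  finally have "infsum ?r I = infsum ?a I - infsum ?f I" by simp
  then show "nrm (ell p I) (\<lambda>i. if i \<in> F then 0 else a i) powr p = infsum ?a I - sum ?a F"
    unfolding nrm_ell_powr[OF assms(1), symmetric] ef .
qed

lemma unit_vec_ell:
  assumes "h \<in> I" shows "unit_vec h \<in> carrier (ell p I)"
proof -
  have "(\<lambda>i. cmod (unit_vec h i) powr p) summable_on {h} \<longleftrightarrow> (\<lambda>i. cmod (unit_vec h i) powr p) summable_on I"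
    using assms by (intro summable_on_cong_neutral) (auto simp: unit_vec_def)
  then show ?thesis using assms by (auto simp: carrier_ell unit_vec_def)
qed

text \<open>Isometries of \<open>\<ell>\<^sup>p(I)\<close> are determined by their values on the standard basis, and translation
  attains the prescribed values, so the definite description in \<^const>\<open>left_regular\<close> is proper.\<close>

lemma isometry_ell_eqI:
  assumes p: "1 \<le> p" and T: "linear_isometry (ell p I) (ell p I) T"
    and S: "linear_isometry (ell p I) (ell p I) S"
    and eq: "\<And>h. h \<in> I \<Longrightarrow> T (unit_vec h) = S (unit_vec h)"
    and a: "a \<in> carrier (ell p I)"
  shows "T a = S a"
proof
  fix k
  let ?E = "carrier (ell p I)"
  let ?c = "\<lambda>F i. if i \<in> F then a i else 0"
  let ?r = "\<lambda>F i. if i \<in> F then 0 else a i"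
  have lin: "L (x + y) = L x + L y" "L (\<lambda>i. c * x i) = (\<lambda>i. c * L x i)" "L x \<in> ?E"
    if "linear_isometry (ell p I) (ell p I) L" "x \<in> ?E" "y \<in> ?E" for L x y c
    using that by (auto simp: linear_isometry_def clinear_map_def scl_ell)
  have iso: "nrm (ell p I) (L x) = nrm (ell p I) x"
    if "linear_isometry (ell p I) (ell p I) L" "x \<in> ?E" for L x
    using that by (auto simp: linear_isometry_def)
  have sc: "(\<lambda>i. c * x i) \<in> ?E" if "x \<in> ?E" for c x
  proof -
    have "module.subspace (scl (ell p I)) ?E" "module (scl (ell p I))"
      using complex_normed_space_ell[OF p, of I]
      by (auto simp: complex_normed_space_def vector_space_def module_def)
    then have "scl (ell p I) c x \<in> ?E" using that by (metis module.subspace_scale)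
    then show ?thesis by (simp add: scl_ell)
  qed
  have c: "T (?c F) = S (?c F)" if "finite F" "F \<subseteq> I" for F
    using that
  proof (induction F rule: finite_induct)
    case empty
    have "?c {} = (\<lambda>i. 0 * a i)" by auto
    then show ?case using lin(2)[OF T a a, of 0] lin(2)[OF S a a, of 0] by simp
  next
    case (insert h F)
    then have F: "finite F" "F \<subseteq> I" "h \<in> I" by auto
    let ?u = "\<lambda>i. a h * unit_vec h i"
    have u: "?u \<in> ?E" by (rule sc[OF unit_vec_ell[OF F(3)]])
    have cF: "?c F \<in> ?E" by (rule ell_split(1)[OF p a F(1,2)])
    have "?c (insert h F) = ?u + ?c F" using insert(2) by (auto simp: unit_vec_def fun_eq_iff)
    moreover have "T ?u = S ?u"
      using lin(2)[OF T unit_vec_ell[OF F(3)] a] lin(2)[OF S unit_vec_ell[OF F(3)] a] eq[OF F(3)] by simp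
    ultimately show ?case
      using lin(1)[OF T u cF] lin(1)[OF S u cF] insert F by simp
  qed
  define d where "d = cmod (T a k - S a k)"
  have "(d / 2) powr p \<le> (\<Sum>\<^sub>\<infinity>i\<in>I. cmod (a i) powr p) - (\<Sum>i\<in>F. cmod (a i) powr p)"
    if F: "finite F" "F \<subseteq> I" for F
  proof -
    note sp = ell_split[OF p a F]
    have split: "a = ?c F + ?r F" by auto
    have "L a = L (?c F) + L (?r F)" if "linear_isometry (ell p I) (ell p I) L" for L
      using arg_cong[OF split, of L] unfolding lin(1)[OF that sp(1,2)] .
    then have "d = cmod (T (?r F) k - S (?r F) k)"
      using T S c[OF F] unfolding d_def by simp
    also have "\<dots> \<le> cmod (T (?r F) k) + cmod (S (?r F) k)" by (rule norm_triangle_ineq4)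
    also have "\<dots> \<le> 2 * nrm (ell p I) (?r F)"
      using coord_le_nrm_ell[OF p lin(3)[OF T sp(2,2)], of k]
        coord_le_nrm_ell[OF p lin(3)[OF S sp(2,2)], of k] iso[OF T sp(2)] iso[OF S sp(2)] by simp
    finally have "(d / 2) powr p \<le> nrm (ell p I) (?r F) powr p"
      using p by (intro powr_mono2) (auto simp: d_def)
    then show ?thesis using sp(3) by simp
  qed
  then have ev: "\<forall>\<^sub>F F in finite_subsets_at_top I.
      (d / 2) powr p \<le> (\<Sum>\<^sub>\<infinity>i\<in>I. cmod (a i) powr p) - (\<Sum>i\<in>F. cmod (a i) powr p)"
    by (auto intro: eventually_finite_subsets_at_top_weakI)
  have "((\<lambda>F. (\<Sum>\<^sub>\<infinity>i\<in>I. cmod (a i) powr p) - (\<Sum>i\<in>F. cmod (a i) powr p)) \<longlongrightarrow>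
      (\<Sum>\<^sub>\<infinity>i\<in>I. cmod (a i) powr p) - (\<Sum>\<^sub>\<infinity>i\<in>I. cmod (a i) powr p)) (finite_subsets_at_top I)"
    using a by (intro tendsto_intros infsum_tendsto) (simp add: carrier_ell)
  then have "(d / 2) powr p \<le> 0"
    using tendsto_lowerbound[OF _ ev] by fastforce
  then show "T a k = S a k" by (simp add: d_def)
qed

definition translation ::
    "real \<Rightarrow> ('g, 'm) monoid_scheme \<Rightarrow> 'g \<Rightarrow> ('g \<Rightarrow> complex) \<Rightarrow> ('g \<Rightarrow> complex)" where
  "translation p G g = (\<lambda>a\<in>carrier (ell p (carrier G)).
     \<lambda>h. if h \<in> carrier G then a (inv\<^bsub>G\<^esub> g \<otimes>\<^bsub>G\<^esub> h) else 0)"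

lemma translation_props:
  fixes G (structure)
  assumes G: "group G" and p: "1 \<le> p" and g: "g \<in> carrier G"
  shows "translation p G g \<in> inv_isometries (ell p (carrier G))"
    and "h \<in> carrier G \<Longrightarrow> translation p G g (unit_vec h) = unit_vec (g \<otimes>\<^bsub>G\<^esub> h)"
proof -
  interpret group G by (rule G)
  let ?E = "carrier (ell p (carrier G))"
  have bij: "bij_betw (\<lambda>h. inv g \<otimes> h) (carrier G) (carrier G)" if "g \<in> carrier G" for g
    using that by (intro bij_betwI[where g = "\<lambda>h. g \<otimes> h"]) (auto simp: m_assoc[symmetric])
  have congs: "(\<lambda>h. cmod (translation p G g a h) powr p) summable_on carrier G \<longleftrightarrow>
      (\<lambda>h. cmod (a (inv g \<otimes> h)) powr p) summable_on carrier G"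
    if "a \<in> ?E" for a g using that by (intro summable_on_cong) (simp add: translation_def)
  have mem: "translation p G g a \<in> ?E" if "g \<in> carrier G" "a \<in> ?E" for g a
  proof -
    have "(\<lambda>h. cmod (a (inv g \<otimes> h)) powr p) summable_on carrier G"
      using that summable_on_reindex_bij_betw[OF bij[OF that(1)], of "\<lambda>h. cmod (a h) powr p"]
      by (simp add: carrier_ell)
    then show ?thesis using congs[OF that(2)] that(2) unfolding carrier_ell[of "translation p G g a"]
      by (simp add: translation_def)
  qed
  have nr: "nrm (ell p (carrier G)) (translation p G g a) = nrm (ell p (carrier G)) a" if "a \<in> ?E" for a
  proof -
    have "(\<Sum>\<^sub>\<infinity>h\<in>carrier G. cmod (translation p G g a h) powr p) =
        (\<Sum>\<^sub>\<infinity>h\<in>carrier G. cmod (a (inv g \<otimes> h)) powr p)"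
      using that by (intro infsum_cong) (simp add: translation_def)
    also have "\<dots> = (\<Sum>\<^sub>\<infinity>h\<in>carrier G. cmod (a h) powr p)"
      by (rule infsum_reindex_bij_betw[OF bij[OF g], of "\<lambda>h. cmod (a h) powr p"])
    finally show ?thesis by (simp add: nrm_ell)
  qed
  have inverse: "translation p G (inv g) (translation p G g a) = a" if "g \<in> carrier G" "a \<in> ?E" for g a
  proof
    fix h
    show "translation p G (inv g) (translation p G g a) h = a h"
      using that mem[OF that] carrier_ell[of a]
      by (cases "h \<in> carrier G") (auto simp: translation_def m_assoc[symmetric])
  qed
  have bb: "bij_betw (translation p G g) ?E ?E"
    using mem[OF g] mem[OF inv_closed[OF g]] inverse[OF g] inverse[OF inv_closed[OF g]] g
    by (intro bij_betwI[where g = "translation p G (inv g)"]) auto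
  have sub: "module.subspace (scl (ell p (carrier G))) ?E" "module (scl (ell p (carrier G)))"
    using complex_normed_space_ell[OF p, of "carrier G"]
    by (auto simp: complex_normed_space_def vector_space_def module_def)
  have "clinear_map (ell p (carrier G)) (ell p (carrier G)) (translation p G g)"
    unfolding clinear_map_def
    using mem[OF g] module.subspace_add[OF sub(2,1)] module.subspace_scale[OF sub(2,1)]
    by (auto simp: translation_def fun_eq_iff scl_ell)
  then show "translation p G g \<in> inv_isometries (ell p (carrier G))"
    using bb nr by (auto simp: inv_isometries_def Bij_def linear_isometry_def translation_def)
  have "inv g \<otimes> k = h \<longleftrightarrow> k = g \<otimes> h" if "h \<in> carrier G" "k \<in> carrier G" for h k
    using that g by (metis inv_solve_left)
  then show "h \<in> carrier G \<Longrightarrow> translation p G g (unit_vec h) = unit_vec (g \<otimes> h)"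
    using g unit_vec_ell[of h "carrier G" p] by (auto simp: translation_def unit_vec_def fun_eq_iff)
qed

lemma left_regular_eq:
  assumes "group G" "1 \<le> p" "g \<in> carrier G"
  shows "left_regular p G g = translation p G g"
  unfolding left_regular_def
proof (rule the_equality)
  show "translation p G g \<in> inv_isometries (ell p (carrier G)) \<and>
      (\<forall>h\<in>carrier G. translation p G g (unit_vec h) = unit_vec (g \<otimes>\<^bsub>G\<^esub> h))"
    using translation_props[OF assms] by blast
  fix T
  assume T: "T \<in> inv_isometries (ell p (carrier G)) \<and> (\<forall>h\<in>carrier G. T (unit_vec h) = unit_vec (g \<otimes>\<^bsub>G\<^esub> h))"
  have T1: "linear_isometry (ell p (carrier G)) (ell p (carrier G)) T" "T \<in> extensional (carrier (ell p (carrier G)))"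
    and T2: "\<And>h. h \<in> carrier G \<Longrightarrow> T (unit_vec h) = unit_vec (g \<otimes>\<^bsub>G\<^esub> h)"
    using T by (auto simp: inv_isometries_def Bij_def)
  have L: "linear_isometry (ell p (carrier G)) (ell p (carrier G)) (translation p G g)"
    "translation p G g \<in> extensional (carrier (ell p (carrier G)))"
    using translation_props(1)[OF assms] by (auto simp: inv_isometries_def Bij_def)
  have "T (unit_vec h) = translation p G g (unit_vec h)" if "h \<in> carrier G" for h
    by (simp only: T2[OF that] translation_props(2)[OF assms that])
  then show "T = translation p G g"
    using isometry_ell_eqI[OF assms(2) T1(1) L(1)] extensionalityI[OF T1(2) L(2)] by blast
qed

lemma inv_isom_rep_left_regular:
  fixes G (structure)
  assumes G: "group G" and p: "1 \<le> p"
  shows "inv_isom_rep G (ell p (carrier G)) (left_regular p G)"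
proof -
  interpret group G by (rule G)
  let ?E = "carrier (ell p (carrier G))"
  have mem: "translation p G g \<in> inv_isometries (ell p (carrier G))" if "g \<in> carrier G" for g
    by (rule translation_props(1)[OF G p that])
  have maps: "translation p G g a \<in> ?E" if "g \<in> carrier G" "a \<in> ?E" for g a
    using mem[OF that(1)] that(2) by (auto simp: inv_isometries_def linear_isometry_def clinear_map_def)
  have "translation p G (g \<otimes> k) = compose ?E (translation p G g) (translation p G k)"
    if "g \<in> carrier G" "k \<in> carrier G" for g k
  proof (rule extensionalityI[where A = ?E])
    show "translation p G (g \<otimes> k) a = compose ?E (translation p G g) (translation p G k) a"
      if "a \<in> ?E" for a
    proof -
      have *: "translation p G x b y = (if y \<in> carrier G then b (inv x \<otimes> y) else 0)" if "b \<in> ?E" for x b y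
        using that by (simp add: translation_def)
      show ?thesis
        using that \<open>g \<in> carrier G\<close> \<open>k \<in> carrier G\<close> maps[OF \<open>k \<in> carrier G\<close> that]
        by (simp add: compose_def fun_eq_iff * inv_mult_group m_assoc)
    qed
  qed (simp_all add: translation_def compose_def)
  moreover have "translation p G g \<in> Bij ?E" if "g \<in> carrier G" for g
    using mem[OF that] by (simp add: inv_isometries_def)
  ultimately show ?thesis
    using mem left_regular_eq[OF G p]
    by (simp add: inv_isom_rep_def hom_def inv_isometry_group_def BijGroup_def Pi_def)
qed

end

theory Submission
  imports Defs
begin

text \<open>
  The intertwining isometry is the analysis operator \<open>\<theta>\<close>, \<open>(\<theta> x) h = f (\<pi> (inv h) x)\<close>, onto its
  range \<open>W\<close>. It intertwines because of how the functionals are indexed: since \<open>\<pi>\<close> is a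
  homomorphism,
  \<open>(\<theta> (\<pi> g x)) h = f (\<pi> (inv h \<otimes> g) x) = f (\<pi> (inv (inv g \<otimes> h)) x) = (\<theta> x) (inv g \<otimes> h)\<close>,
  and the left regular representation acts by exactly this translation. Hence \<open>W\<close> is invariant.
  It is closed because \<open>\<theta>\<close> is isometric on a complete space: a sequence in \<open>W\<close>
  that converges in \<open>\<ell>\<^sup>p(G)\<close> is the image of a Cauchy sequence in \<open>X\<close>, whose limit is mapped to
  the given one. Finally, the restriction of a representation to an invariant subspace is again
  invertible, because the inverse of \<open>\<pi> g\<close> is \<open>\<pi> (inv g)\<close>, which preserves the
  subspace as well.
\<close>

section \<open>Linear isometries of complete spaces\<close>

lemma complex_normed_space_diff:
  assumes "complex_normed_space X" "x \<in> carrier X" "y \<in> carrier X"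
  shows "x - y \<in> carrier X"
proof -
  interpret vector_space "scl X" using assms(1) by (simp add: complex_normed_space_def)
  show ?thesis using assms by (auto simp: complex_normed_space_def intro: subspace_diff)
qed

lemma linear_isometry_closed:
  "linear_isometry X Y T \<Longrightarrow> x \<in> carrier X \<Longrightarrow> T x \<in> carrier Y"
  by (auto simp: linear_isometry_def clinear_map_def)

lemma linear_isometry_ndist:
  assumes "complex_normed_space X" "linear_isometry X Y T" "x \<in> carrier X" "y \<in> carrier X"
  shows "ndist Y (T x) (T y) = ndist X x y"
proof -
  have d: "x - y \<in> carrier X" by (rule complex_normed_space_diff) (use assms in auto)
  have "T ((x - y) + y) = T (x - y) + T y"
    using assms(2,4) d unfolding linear_isometry_def clinear_map_def by blast
  then have "T x - T y = T (x - y)" by simp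
  then show ?thesis
    using assms d by (auto simp: ndist_def linear_isometry_def clinear_map_def)
qed

lemma linear_isometry_inj_on:
  assumes X: "complex_normed_space X" and Y: "complex_normed_space Y"
    and T: "linear_isometry X Y T"
  shows "inj_on T (carrier X)"
proof (rule inj_onI)
  fix x y assume xy: "x \<in> carrier X" "y \<in> carrier X" "T x = T y"
  have "ndist X x y = ndist Y (T x) (T y)"
    using linear_isometry_ndist[OF X T xy(1,2)] by simp
  also have "\<dots> = 0"
    using Metric_space.zero[OF Metric_space_ndist[OF Y]] linear_isometry_closed[OF T] xy by simp
  finally show "x = y"
    using Metric_space.zero[OF Metric_space_ndist[OF X]] xy by simp
qed

lemma subspace_linear_isometry_image:
  assumes X: "complex_normed_space X" and Y: "complex_normed_space Y"
    and T: "linear_isometry X Y T"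
  shows "module.subspace (scl Y) (T ` carrier X)"
proof -
  interpret X: vector_space "scl X" using X by (simp add: complex_normed_space_def)
  interpret Y: vector_space "scl Y" using Y by (simp add: complex_normed_space_def)
  have sX: "X.subspace (carrier X)" using X by (simp add: complex_normed_space_def)
  have add: "T (x + y) = T x + T y" if "x \<in> carrier X" "y \<in> carrier X" for x y
    using T that by (auto simp: linear_isometry_def clinear_map_def)
  have scl: "T (scl X c x) = scl Y c (T x)" if "x \<in> carrier X" for c x
    using T that by (auto simp: linear_isometry_def clinear_map_def)
  show ?thesis
  proof (rule Y.subspaceI)
    have 0: "0 \<in> carrier X" by (rule X.subspace_0[OF sX])
    then show "0 \<in> T ` carrier X" using add[OF 0 0] by (auto intro: image_eqI[of _ _ 0])
  next
    fix u v assume "u \<in> T ` carrier X" "v \<in> T ` carrier X"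
    then obtain x y where *: "x \<in> carrier X" "y \<in> carrier X" "u = T x" "v = T y" by blast
    show "u + v \<in> T ` carrier X"
      using add[of x y] X.subspace_add[OF sX, of x y] * by (intro image_eqI[of _ _ "x + y"]) auto
  next
    fix c u assume "u \<in> T ` carrier X"
    then obtain x where *: "x \<in> carrier X" "u = T x" by blast
    show "scl Y c u \<in> T ` carrier X"
      using scl[of x c] X.subspace_scale[OF sX, of x c] *
      by (intro image_eqI[of _ _ "scl X c x"]) auto
  qed
qed

text \<open>The Cauchy property of a convergent sequence of images is pulled back along the isometry;
  completeness of the domain then produces a preimage of its limit.\<close>

lemma closedin_linear_isometry_image:
  assumes X: "complex_normed_space X" and complete: "Metric_space.mcomplete (carrier X) (ndist X)"
    and Y: "complex_normed_space Y" and T: "linear_isometry X Y T"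
  shows "closedin (ntop Y) (T ` carrier X)"
proof -
  interpret X: Metric_space "carrier X" "ndist X" by (rule Metric_space_ndist[OF X])
  interpret Y: Metric_space "carrier Y" "ndist Y" by (rule Metric_space_ndist[OF Y])
  have sub: "T ` carrier X \<subseteq> carrier Y" using linear_isometry_closed[OF T] by auto
  have "l \<in> T ` carrier X"
    if ran: "range \<sigma> \<subseteq> T ` carrier X" and lim: "limitin Y.mtopology \<sigma> l sequentially" for \<sigma> l
  proof -
    have "\<forall>n. \<exists>x\<in>carrier X. \<sigma> n = T x" using ran by blast
    then obtain s where s: "\<And>n. s n \<in> carrier X" "\<And>n. \<sigma> n = T (s n)" by metis
    have "Y.MCauchy \<sigma>" using Y.convergent_imp_MCauchy[OF _ lim] ran sub by blast
    then have "X.MCauchy s"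
      using s linear_isometry_ndist[OF X T] by (simp add: X.MCauchy_def Y.MCauchy_def image_subset_iff)
    then obtain x where x: "limitin X.mtopology s x sequentially"
      using complete by (auto simp: X.mcomplete_def)
    then have xX: "x \<in> carrier X" by (simp add: X.limitin_metric)
    have "limitin Y.mtopology \<sigma> (T x) sequentially"
      using x xX s linear_isometry_ndist[OF X T] linear_isometry_closed[OF T]
      by (simp add: X.limitin_metric Y.limitin_metric)
    then have "l = T x" using Y.limitin_metric_unique[OF lim] by simp
    then show ?thesis using xX by blast
  qed
  then show ?thesis
    using sub unfolding ntop_def Y.metric_closedin_iff_sequentially_closed by blast
qed

section \<open>Invertible isometric representations\<close>

lemma inv_isom_rep_inv_isometries:
  "inv_isom_rep G X \<pi> \<Longrightarrow> g \<in> carrier G \<Longrightarrow> \<pi> g \<in> inv_isometries X"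
  by (auto simp: inv_isom_rep_def hom_def inv_isometry_group_def)

lemma inv_isom_rep_linear_isometry:
  "inv_isom_rep G X \<pi> \<Longrightarrow> g \<in> carrier G \<Longrightarrow> linear_isometry X X (\<pi> g)"
  using inv_isom_rep_inv_isometries[of G X \<pi> g] by (simp add: inv_isometries_def)

lemma inv_isom_rep_closed:
  "inv_isom_rep G X \<pi> \<Longrightarrow> g \<in> carrier G \<Longrightarrow> x \<in> carrier X \<Longrightarrow> \<pi> g x \<in> carrier X"
  by (rule linear_isometry_closed[OF inv_isom_rep_linear_isometry])

lemma inv_isom_rep_mult:
  fixes G (structure)
  assumes "inv_isom_rep G X \<pi>" "g \<in> carrier G" "h \<in> carrier G" "x \<in> carrier X"
  shows "\<pi> (g \<otimes> h) x = \<pi> g (\<pi> h x)"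
proof -
  have "\<pi> g \<in> Bij (carrier X)" "\<pi> h \<in> Bij (carrier X)"
    using inv_isom_rep_inv_isometries[OF assms(1)] assms(2,3) by (auto simp: inv_isometries_def)
  then have "\<pi> (g \<otimes> h) = compose (carrier X) (\<pi> g) (\<pi> h)"
    using assms(1-3) by (simp add: inv_isom_rep_def hom_def inv_isometry_group_def BijGroup_def)
  then show ?thesis using assms(4) by (simp add: compose_eq)
qed

lemma inv_isom_rep_one:
  fixes G (structure)
  assumes "group G" "inv_isom_rep G X \<pi>" "x \<in> carrier X"
  shows "\<pi> \<one> x = x"
proof -
  interpret group G by (rule assms(1))
  have "inj_on (\<pi> \<one>) (carrier X)"
    using inv_isom_rep_inv_isometries[OF assms(2) one_closed]
    by (simp add: inv_isometries_def Bij_def bij_betw_def)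
  moreover have "\<pi> \<one> (\<pi> \<one> x) = \<pi> \<one> x"
    using inv_isom_rep_mult[OF assms(2) one_closed one_closed assms(3)] by simp
  ultimately show ?thesis
    using inv_isom_rep_closed[OF assms(2) one_closed] assms(3) by (auto dest: inj_onD)
qed

text \<open>Surjectivity on \<open>W\<close> is the only point at issue: it needs invariance under the whole group,
  since a single isometry may map a closed subspace onto a proper part of itself.\<close>

lemma inv_isom_rep_restrict:
  fixes G (structure)
  assumes G: "group G" and rep: "inv_isom_rep G X \<pi>" and norm: "complex_normed_space X"
    and W: "W \<subseteq> carrier X" "module.subspace (scl X) W"
    and inv: "\<And>g. g \<in> carrier G \<Longrightarrow> \<pi> g ` W \<subseteq> W"
  shows "inv_isom_rep G (X\<lparr>carrier := W\<rparr>) (\<lambda>g. restrict (\<pi> g) W)"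
proof -
  interpret group G by (rule G)
  interpret V: vector_space "scl X" using norm by (simp add: complex_normed_space_def)
  let ?Y = "X\<lparr>carrier := W\<rparr>"
  note mult = inv_isom_rep_mult[OF rep] and one = inv_isom_rep_one[OF G rep]
  have bij: "restrict (\<pi> g) W \<in> Bij W" if g: "g \<in> carrier G" for g
  proof -
    have "bij_betw (restrict (\<pi> g) W) W W"
    proof (rule bij_betwI[where g = "\<pi> (inv g)"])
      show "restrict (\<pi> g) W \<in> W \<rightarrow> W" using inv[OF g] by auto
      show "\<pi> (inv g) \<in> W \<rightarrow> W" using inv[of "inv g"] g by auto
      show "\<pi> (inv g) (restrict (\<pi> g) W x) = x" if "x \<in> W" for x
        using that W(1) g mult[of "inv g" g x] one[of x] by auto
      show "restrict (\<pi> g) W (\<pi> (inv g) x) = x" if "x \<in> W" for x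
        using that W(1) g mult[of g "inv g" x] one[of x] inv[of "inv g"] by auto
    qed
    then show ?thesis by (simp add: Bij_def)
  qed
  have iso: "linear_isometry ?Y ?Y (restrict (\<pi> g) W)" if g: "g \<in> carrier G" for g
    using inv_isom_rep_linear_isometry[OF rep g] inv[OF g] W(1)
      V.subspace_add[OF W(2)] V.subspace_scale[OF W(2)]
    by (auto simp: linear_isometry_def clinear_map_def subset_iff)
  have "restrict (\<pi> (g \<otimes> h)) W = compose W (restrict (\<pi> g) W) (restrict (\<pi> h) W)"
    if "g \<in> carrier G" "h \<in> carrier G" for g h
    using that W(1) mult[of g h] inv[of h] by (auto simp: compose_def fun_eq_iff)
  then show ?thesis
    using bij iso
    by (simp add: inv_isom_rep_def hom_def inv_isometry_group_def BijGroup_def inv_isometries_def)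
qed

section \<open>Intertwining by the analysis operator\<close>

lemma analysis_op_intertwines:
  fixes G (structure)
  assumes G: "group G" and p: "1 \<le> p" and rep: "inv_isom_rep G X \<pi>"
    and fs: "\<And>g x. g \<in> carrier G \<Longrightarrow> x \<in> carrier X \<Longrightarrow> fs g x = f (\<pi> (inv g) x)"
    and ell: "analysis_op (carrier G) fs x \<in> carrier (ell p (carrier G))"
    and g: "g \<in> carrier G" and x: "x \<in> carrier X"
  shows "analysis_op (carrier G) fs (\<pi> g x) = left_regular p G g (analysis_op (carrier G) fs x)"
proof -
  interpret group G by (rule G)
  have "fs h (\<pi> g x) = fs (inv g \<otimes> h) x" if h: "h \<in> carrier G" for h
  proof -
    have "fs h (\<pi> g x) = f (\<pi> (inv h) (\<pi> g x))"
      by (rule fs[OF h inv_isom_rep_closed[OF rep g x]])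
    also have "\<pi> (inv h) (\<pi> g x) = \<pi> (inv (inv g \<otimes> h)) x"
      using inv_isom_rep_mult[OF rep inv_closed[OF h] g x] g h by (simp add: inv_mult_group)
    finally show ?thesis using fs[of "inv g \<otimes> h" x] g h x by simp
  qed
  then show ?thesis
    using g ell by (simp add: left_regular_eq[OF G p g] translation_def analysis_op_def fun_eq_iff)
qed

theorem theorem2p8:
  fixes G :: "('g, 'm) monoid_scheme"
    and p :: real
    and X :: "('v::ab_group_add) cnspace"
    and \<pi> :: "'g \<Rightarrow> 'v \<Rightarrow> 'v"
  assumes "discrete_group G"
    and "1 \<le> p"
    and "separable_cbanach X"
    and "p_usf_rep p G X \<pi>"
  shows "\<exists>Y \<rho>. is_subrep G (ell p (carrier G)) (left_regular p G) Y \<rho> \<and>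
               inv_isom_equivalent G X \<pi> Y \<rho>"
proof -
  have G: "group G" using assms(1) by (simp add: discrete_group_def)
  have X: "complex_normed_space X" "Metric_space.mcomplete (carrier X) (ndist X)"
    using assms(3) by (auto simp: separable_cbanach_def)
  let ?L = "ell p (carrier G)"
  note L = complex_normed_space_ell[OF assms(2), of "carrier G"]
  obtain fs f where rep: "inv_isom_rep G X \<pi>"
    and fs: "\<And>g x. g \<in> carrier G \<Longrightarrow> x \<in> carrier X \<Longrightarrow> fs g x = f (\<pi> (inv\<^bsub>G\<^esub> g) x)"
    and iso: "linear_isometry X ?L (analysis_op (carrier G) fs)"
    using assms(4) by (auto simp: p_usf_rep_def group_p_usf_def group_usf_def)
  define T where "T = analysis_op (carrier G) fs"
  define W where "W = T ` carrier X"
  have T: "linear_isometry X ?L T" using iso by (simp add: T_def)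
  have tw: "T (\<pi> g x) = left_regular p G g (T x)" if "g \<in> carrier G" "x \<in> carrier X" for g x
    using analysis_op_intertwines[OF G assms(2) rep fs linear_isometry_closed[OF iso] that] that
    by (simp add: T_def)
  have WL: "W \<subseteq> carrier ?L" using linear_isometry_closed[OF T] by (auto simp: W_def)
  have inv: "left_regular p G g ` W \<subseteq> W" if "g \<in> carrier G" for g
    using inv_isom_rep_closed[OF rep that] by (auto simp: W_def tw[OF that, symmetric])
  have sub: "module.subspace (scl ?L) W"
    unfolding W_def by (rule subspace_linear_isometry_image[OF X(1) L T])
  define Y where "Y = ?L\<lparr>carrier := W\<rparr>"
  define \<rho> where "\<rho> = (\<lambda>g. restrict (left_regular p G g) W)"
  have "closed_invariant_subspace G ?L (left_regular p G) W"
    using WL sub inv closedin_linear_isometry_image[OF X L T]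
    by (simp add: closed_invariant_subspace_def W_def)
  then have "is_subrep G ?L (left_regular p G) Y \<rho>"
    unfolding is_subrep_def Y_def \<rho>_def by blast
  moreover have "inv_isom_rep G Y \<rho>"
    unfolding Y_def \<rho>_def
    by (rule inv_isom_rep_restrict[OF G inv_isom_rep_left_regular[OF G assms(2)] L WL sub inv])
  moreover have "linear_isometry X Y T"
    using T by (auto simp: Y_def W_def linear_isometry_def clinear_map_def)
  moreover have "bij_betw T (carrier X) (carrier Y)"
    using linear_isometry_inj_on[OF X(1) L T] by (simp add: Y_def W_def bij_betw_def)
  moreover have "T (\<pi> g x) = \<rho> g (T x)" if "g \<in> carrier G" "x \<in> carrier X" for g x
    using tw[OF that] that by (simp add: \<rho>_def W_def)
  ultimately show ?thesis
    using rep unfolding inv_isom_equivalent_def by blast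
qed

end
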